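(* Let $(M,\omega)$ be a closed symplectic manifold and $\zeta\colon C(M)\to\mathbb{R}$ a partial symplectic quasi-state on $(M,\omega)$. Then every $\zeta$-NPH-stem in $M$ is $\zeta$-superheavy.
   Context: $C(M)$ (resp. $C^\infty(M)$) is the set of continuous (resp. smooth) real-valued functions on $M$. A subspace $\mathbb{A}\subset C^\infty(M)$ is Poisson-commutative if $\{F,G\}=0$ for all $F,G\in\mathbb{A}$; if $\mathbb{A}$ is finite-dimensional, its moment map $\Phi\colon M\to\mathbb{A}^\ast$ is given by $F(x)=\langle\Phi(x),F\rangle$ for $x\in M$, $F\in\mathbb{A}$. For a (smooth) Hamiltonian $H\colon S^1\times M\to\mathbb{R}$ ($S^1=\mathbb{R}/\mathbb{Z}$, $H_t=H(t,\cdot)$), the Hamiltonian vector field is defined by $\iota_{X_{H_t}}\omega=-dH_t$, and $\varphi_H$ is the time-1 map of its flow; $\mathrm{Ham}(M,\omega)$ is the group of all such $\varphi_H$. A subset $X\subset M$ is displaceable from $Y\subset M$ if there is $H$ with $\varphi_H(X)\cap\overline{Y}=\emptyset$. A partial symplectic quasi-state on $(M,\omega)$ is a functional $\zeta\colon C(M)\to\mathbb{R}$ such that: (Normalization) $\zeta(a)=a$ for every constant function $a$; (Stability) $\min_M(H_1-H_2)\le\zeta(H_1)-\zeta(H_2)\le\max_M(H_1-H_2)$ for all $H_1,H_2\in C(M)$; (Semi-homogeneity) $\zeta(sH)=s\zeta(H)$ for all $H\in C(M)$, $s>0$; (Hamiltonian invariance) $\zeta(H\circ\phi)=\zeta(H)$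 for all $H\in C(M)$, $\phi\in\mathrm{Ham}(M,\omega)$; (Vanishing) $\zeta(H)=0$ for every $H\in C(M)$ whose support is displaceable from itself; (Quasi-subadditivity) $\zeta(H_1+H_2)\le\zeta(H_1)+\zeta(H_2)$ for all $H_1,H_2\in C^\infty(M)$ with $\{H_1,H_2\}=0$. For an open $U\subset M$, $\mathcal{H}(U)$ is the set of functions in $C(M)$ whose support is contained in $U$. A closed subset $X\subset M$ is $\zeta$-pseudoheavy if for every open neighborhood $U$ of $X$ there exists $F\in\mathcal{H}(U)$ with $\zeta(F)>0$. A closed subset $X\subset M$ is $\zeta$-superheavy if $\zeta(H)\le\sup_X H$ for every $H\in C(M)$. A closed subset $X\subset M$ is a $\zeta$-NPH-stem if there exists a finite-dimensional Poisson-commutative subspace $\mathbb{A}$ of $C^\infty(M)$, with moment map $\Phi$, such that (1) $X=\Phi^{-1}(p)$ for some $p\in\Phi(M)$, and (2) every non-trivial (i.e. non-empty) fiber of $\Phi$ other than $X$ is not $\zeta$-pseudoheavy. *)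

theory Defs
  imports "HOL-Analysis.Analysis"
begin

section \<open>Smooth maps between normed spaces\<close>

text \<open>Meant for open sets only. In finite dimension, continuity of all iterated directional
  derivatives up to order \<open>n\<close> is the usual notion of class \<open>C\<^sup>n\<close>.\<close>

fun higher_differentiable_on ::
    "'e::real_normed_vector set \<Rightarrow> ('e \<Rightarrow> 'f::real_normed_vector) \<Rightarrow> nat \<Rightarrow> bool" where
  "higher_differentiable_on S f 0 \<longleftrightarrow> continuous_on S f"
| "higher_differentiable_on S f (Suc n) \<longleftrightarrow>
     (\<forall>x\<in>S. f differentiable (at x)) \<and>
     (\<forall>v. higher_differentiable_on S (\<lambda>x. frechet_derivative f (at x) v) n)"

definition smooth_on :: "'e::real_normed_vector set \<Rightarrow> ('e \<Rightarrow> 'f::real_normed_vector) \<Rightarrow> bool" where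
  "smooth_on S f \<longleftrightarrow> (\<forall>n. higher_differentiable_on S f n)"


section \<open>Manifolds and symplectic forms\<close>

text \<open>The manifold is a whole type \<open>'a\<close>, modelled on a finite-dimensional space \<open>'e\<close>. (The sort
  \<^class>\<open>euclidean_space\<close> for \<open>'e\<close> would exclude dimension \<open>0\<close>.) A chart is a pair of a domain and a
  coordinate map; the values of the coordinate map outside its domain are irrelevant.\<close>

type_synonym ('a, 'e) chart = "'a set \<times> ('a \<Rightarrow> 'e)"

abbreviation dom_chart :: "('a, 'e) chart \<Rightarrow> 'a set" where
  "dom_chart c \<equiv> fst c"

abbreviation coord :: "('a, 'e) chart \<Rightarrow> 'a \<Rightarrow> 'e" where
  "coord c \<equiv> snd c"

definition img_chart :: "('a, 'e) chart \<Rightarrow> 'e set" where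
  "img_chart c = coord c ` dom_chart c"

definition inv_chart :: "('a, 'e) chart \<Rightarrow> 'e \<Rightarrow> 'a" where
  "inv_chart c = inv_into (dom_chart c) (coord c)"

definition transition :: "('a, 'e) chart \<Rightarrow> ('a, 'e) chart \<Rightarrow> 'e \<Rightarrow> 'e" where
  "transition c d = coord d \<circ> inv_chart c"

locale smooth_manifold =
  fixes \<A> :: "('a::{t2_space, second_countable_topology}, 'e::real_normed_vector) chart set"
  assumes finite_dimensional: "\<exists>B :: 'e set. finite B \<and> span B = UNIV"
    and covers: "(\<Union>c\<in>\<A>. dom_chart c) = UNIV"
    and open_dom: "c \<in> \<A> \<Longrightarrow> open (dom_chart c)"
    and open_img: "c \<in> \<A> \<Longrightarrow> open (img_chart c)"
    and homeo: "c \<in> \<A> \<Longrightarrow> homeomorphism (dom_chart c) (img_chart c) (coord c) (inv_chart c)"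
    and smooth_transition: "c \<in> \<A> \<Longrightarrow> d \<in> \<A> \<Longrightarrow>
      smooth_on (coord c ` (dom_chart c \<inter> dom_chart d)) (transition c d)"

text \<open>A 2-form is given by its coordinate representations: \<open>\<omega> c x v w\<close> is the value at the point
  \<open>x \<in> dom_chart c\<close> on the two tangent vectors whose coordinates in the chart \<open>c\<close> are \<open>v\<close>
  and \<open>w\<close>. The assumption \<open>compatible\<close> says that this value does not depend on the chart.
  In \<open>closed\<close>, the left-hand side is \<open>d\<omega>(u, v, w)\<close> for the constant
  coordinate vector fields \<open>u, v, w\<close>.\<close>

locale closed_symplectic_manifold = smooth_manifold \<A>
  for \<A> :: "('a::{t2_space, second_countable_topology}, 'e::real_normed_vector) chart set" +
  fixes \<omega> :: "('a, 'e) chart \<Rightarrow> 'a \<Rightarrow> 'e \<Rightarrow> 'e \<Rightarrow> real"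
  assumes compact_manifold: "compact (UNIV :: 'a set)"
    and bilinear: "c \<in> \<A> \<Longrightarrow> x \<in> dom_chart c \<Longrightarrow> bilinear (\<omega> c x)"
    and alternating: "c \<in> \<A> \<Longrightarrow> x \<in> dom_chart c \<Longrightarrow> \<omega> c x v v = 0"
    and compatible: "c \<in> \<A> \<Longrightarrow> d \<in> \<A> \<Longrightarrow> x \<in> dom_chart c \<Longrightarrow> x \<in> dom_chart d \<Longrightarrow>
      \<omega> c x v w = \<omega> d x (frechet_derivative (transition c d) (at (coord c x)) v)
                       (frechet_derivative (transition c d) (at (coord c x)) w)"
    and smooth_form: "c \<in> \<A> \<Longrightarrow> smooth_on (img_chart c) (\<lambda>y. \<omega> c (inv_chart c y) v w)"
    and nondegenerate: "c \<in> \<A> \<Longrightarrow> x \<in> dom_chart c \<Longrightarrow> (\<forall>w. \<omega> c x v w = 0) \<Longrightarrow> v = 0"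
    and closed: "c \<in> \<A> \<Longrightarrow> y \<in> img_chart c \<Longrightarrow>
      frechet_derivative (\<lambda>z. \<omega> c (inv_chart c z) v w) (at y) u
      + frechet_derivative (\<lambda>z. \<omega> c (inv_chart c z) w u) (at y) v
      + frechet_derivative (\<lambda>z. \<omega> c (inv_chart c z) u v) (at y) w = 0"


section \<open>Functions, Poisson brackets and Hamiltonian diffeomorphisms\<close>

definition continuous_functions :: "('a::topological_space \<Rightarrow> real) set" where
  "continuous_functions = {f. continuous_on UNIV f}"

definition smooth_functions ::
    "('a, 'e::real_normed_vector) chart set \<Rightarrow> ('a \<Rightarrow> real) set" where
  "smooth_functions \<A> = {f. \<forall>c\<in>\<A>. smooth_on (img_chart c) (f \<circ> inv_chart c)}"

text \<open>The differential of \<open>f\<close> at \<open>x\<close> and the Hamiltonian vector field of \<open>f\<close> at \<open>x\<close>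
  (\<open>\<iota>\<^bsub>X\<^esub>\<omega> = -df\<close>), both in the coordinates of the chart \<open>c\<close>.\<close>

definition diff_chart ::
    "('a, 'e::real_normed_vector) chart \<Rightarrow> ('a \<Rightarrow> real) \<Rightarrow> 'a \<Rightarrow> 'e \<Rightarrow> real" where
  "diff_chart c f x = frechet_derivative (f \<circ> inv_chart c) (at (coord c x))"

definition ham_vector_field ::
    "(('a, 'e) chart \<Rightarrow> 'a \<Rightarrow> 'e \<Rightarrow> 'e \<Rightarrow> real) \<Rightarrow> ('a, 'e::real_normed_vector) chart \<Rightarrow>
      ('a \<Rightarrow> real) \<Rightarrow> 'a \<Rightarrow> 'e" where
  "ham_vector_field \<omega> c f x = (THE X. \<forall>w. \<omega> c x X w = - diff_chart c f x w)"

text \<open>The bracket \<open>{f, g} = \<omega>(X\<^sub>g, X\<^sub>f)\<close>, computed at \<open>x\<close> in the chart \<open>c\<close>; by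
  compatibility of \<open>\<omega>\<close>, the value is independent of the chart around \<open>x\<close>.\<close>

definition poisson_bracket ::
    "(('a, 'e) chart \<Rightarrow> 'a \<Rightarrow> 'e \<Rightarrow> 'e \<Rightarrow> real) \<Rightarrow> ('a, 'e::real_normed_vector) chart \<Rightarrow>
      ('a \<Rightarrow> real) \<Rightarrow> ('a \<Rightarrow> real) \<Rightarrow> 'a \<Rightarrow> real" where
  "poisson_bracket \<omega> c f g x = \<omega> c x (ham_vector_field \<omega> c g x) (ham_vector_field \<omega> c f x)"

definition poisson_commute ::
    "('a, 'e::real_normed_vector) chart set \<Rightarrow> (('a, 'e) chart \<Rightarrow> 'a \<Rightarrow> 'e \<Rightarrow> 'e \<Rightarrow> real) \<Rightarrow>
      ('a \<Rightarrow> real) \<Rightarrow> ('a \<Rightarrow> real) \<Rightarrow> bool" where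
  "poisson_commute \<A> \<omega> f g \<longleftrightarrow> (\<forall>c\<in>\<A>. \<forall>x\<in>dom_chart c. poisson_bracket \<omega> c f g x = 0)"

text \<open>A smooth function on \<open>S\<^sup>1 \<times> M\<close> is a smooth function on \<open>\<real> \<times> M\<close> that is 1-periodic in time.\<close>

definition time_periodic_hamiltonian ::
    "('a, 'e::real_normed_vector) chart set \<Rightarrow> (real \<Rightarrow> 'a \<Rightarrow> real) \<Rightarrow> bool" where
  "time_periodic_hamiltonian \<A> H \<longleftrightarrow>
     (\<forall>t x. H (t + 1) x = H t x) \<and>
     (\<forall>c\<in>\<A>. smooth_on (UNIV \<times> img_chart c) (\<lambda>(t, y). H t (inv_chart c y)))"

definition hamiltonian_flow ::
    "('a::topological_space, 'e::real_normed_vector) chart set \<Rightarrow>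
      (('a, 'e) chart \<Rightarrow> 'a \<Rightarrow> 'e \<Rightarrow> 'e \<Rightarrow> real) \<Rightarrow>
      (real \<Rightarrow> 'a \<Rightarrow> real) \<Rightarrow> (real \<Rightarrow> 'a \<Rightarrow> 'a) \<Rightarrow> bool" where
  "hamiltonian_flow \<A> \<omega> H \<phi> \<longleftrightarrow>
     (\<forall>x. \<phi> 0 x = x) \<and>
     (\<forall>x. continuous_on UNIV (\<lambda>t. \<phi> t x)) \<and>
     (\<forall>c\<in>\<A>. \<forall>t x. \<phi> t x \<in> dom_chart c \<longrightarrow>
        ((\<lambda>s. coord c (\<phi> s x)) has_vector_derivative ham_vector_field \<omega> c (H t) (\<phi> t x)) (at t))"

definition Ham ::
    "('a::topological_space, 'e::real_normed_vector) chart set \<Rightarrow>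
      (('a, 'e) chart \<Rightarrow> 'a \<Rightarrow> 'e \<Rightarrow> 'e \<Rightarrow> real) \<Rightarrow> ('a \<Rightarrow> 'a) set" where
  "Ham \<A> \<omega> = {\<phi> 1 | \<phi> H. time_periodic_hamiltonian \<A> H \<and> hamiltonian_flow \<A> \<omega> H \<phi>}"

definition displaceable_from ::
    "('a::topological_space, 'e::real_normed_vector) chart set \<Rightarrow>
      (('a, 'e) chart \<Rightarrow> 'a \<Rightarrow> 'e \<Rightarrow> 'e \<Rightarrow> real) \<Rightarrow> 'a set \<Rightarrow> 'a set \<Rightarrow> bool" where
  "displaceable_from \<A> \<omega> X Y \<longleftrightarrow> (\<exists>\<phi>\<in>Ham \<A> \<omega>. \<phi> ` X \<inter> closure Y = {})"

definition supp :: "('a::topological_space \<Rightarrow> real) \<Rightarrow> 'a set" where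
  "supp f = closure {x. f x \<noteq> 0}"

definition supported_functions :: "'a::topological_space set \<Rightarrow> ('a \<Rightarrow> real) set" where
  "supported_functions U = {f \<in> continuous_functions. supp f \<subseteq> U}"


section \<open>Partial symplectic quasi-states\<close>

text \<open>A functional on \<open>C(M)\<close> is a function on all of \<^typ>\<open>'a \<Rightarrow> real\<close> of which only the values on
  continuous functions are constrained. On a closed manifold, the infima and suprema in
  \<open>stability\<close> are attained.\<close>

locale partial_symplectic_quasi_state = closed_symplectic_manifold \<A> \<omega>
  for \<A> :: "('a::{t2_space, second_countable_topology}, 'e::real_normed_vector) chart set"
    and \<omega> :: "('a, 'e) chart \<Rightarrow> 'a \<Rightarrow> 'e \<Rightarrow> 'e \<Rightarrow> real" +
  fixes \<zeta> :: "('a \<Rightarrow> real) \<Rightarrow> real"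
  assumes normalization: "\<zeta> (\<lambda>_. a) = a"
    and stability: "H1 \<in> continuous_functions \<Longrightarrow> H2 \<in> continuous_functions \<Longrightarrow>
      (INF x. H1 x - H2 x) \<le> \<zeta> H1 - \<zeta> H2 \<and> \<zeta> H1 - \<zeta> H2 \<le> (SUP x. H1 x - H2 x)"
    and semi_homogeneity: "H \<in> continuous_functions \<Longrightarrow> s > 0 \<Longrightarrow> \<zeta> (\<lambda>x. s * H x) = s * \<zeta> H"
    and hamiltonian_invariance: "H \<in> continuous_functions \<Longrightarrow> \<phi> \<in> Ham \<A> \<omega> \<Longrightarrow> \<zeta> (H \<circ> \<phi>) = \<zeta> H"
    and vanishing: "H \<in> continuous_functions \<Longrightarrow> displaceable_from \<A> \<omega> (supp H) (supp H) \<Longrightarrow> \<zeta> H = 0"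
    and quasi_subadditivity: "H1 \<in> smooth_functions \<A> \<Longrightarrow> H2 \<in> smooth_functions \<A> \<Longrightarrow>
      poisson_commute \<A> \<omega> H1 H2 \<Longrightarrow> \<zeta> (\<lambda>x. H1 x + H2 x) \<le> \<zeta> H1 + \<zeta> H2"

definition pseudoheavy :: "(('a::topological_space \<Rightarrow> real) \<Rightarrow> real) \<Rightarrow> 'a set \<Rightarrow> bool" where
  "pseudoheavy \<zeta> X \<longleftrightarrow>
     closed X \<and> (\<forall>U. open U \<and> X \<subseteq> U \<longrightarrow> (\<exists>F\<in>supported_functions U. \<zeta> F > 0))"

text \<open>The supremum is taken in \<^typ>\<open>ereal\<close> so that the supremum over the empty set is \<open>-\<infinity>\<close>.\<close>

definition superheavy :: "(('a::topological_space \<Rightarrow> real) \<Rightarrow> real) \<Rightarrow> 'a set \<Rightarrow> bool" where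
  "superheavy \<zeta> X \<longleftrightarrow>
     closed X \<and> (\<forall>H\<in>continuous_functions. ereal (\<zeta> H) \<le> (SUP x\<in>X. ereal (H x)))"


section \<open>Moment maps and stems\<close>

definition finite_dimensional_subspace :: "('a \<Rightarrow> real) set \<Rightarrow> bool" where
  "finite_dimensional_subspace V \<longleftrightarrow>
     (\<lambda>_. 0) \<in> V \<and>
     (\<forall>F\<in>V. \<forall>G\<in>V. (\<lambda>x. F x + G x) \<in> V) \<and>
     (\<forall>a. \<forall>F\<in>V. (\<lambda>x. a * F x) \<in> V) \<and>
     (\<exists>B. finite B \<and> B \<subseteq> V \<and> (\<forall>F\<in>V. \<exists>a. F = (\<lambda>x. \<Sum>G\<in>B. a G * G x)))"

definition poisson_commutative ::
    "('a, 'e::real_normed_vector) chart set \<Rightarrow> (('a, 'e) chart \<Rightarrow> 'a \<Rightarrow> 'e \<Rightarrow> 'e \<Rightarrow> real) \<Rightarrow>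
      ('a \<Rightarrow> real) set \<Rightarrow> bool" where
  "poisson_commutative \<A> \<omega> V \<longleftrightarrow>
     V \<subseteq> smooth_functions \<A> \<and>
     (\<forall>F\<in>V. \<forall>G\<in>V. poisson_commute \<A> \<omega> F G)"

text \<open>Linear functionals on \<open>V\<close>, represented as extensional functions.\<close>

definition dual_space :: "('a \<Rightarrow> real) set \<Rightarrow> (('a \<Rightarrow> real) \<Rightarrow> real) set" where
  "dual_space V = {l \<in> extensional V.
     (\<forall>F\<in>V. \<forall>G\<in>V. l (\<lambda>x. F x + G x) = l F + l G) \<and>
     (\<forall>a. \<forall>F\<in>V. l (\<lambda>x. a * F x) = a * l F)}"

definition moment_map :: "('a \<Rightarrow> real) set \<Rightarrow> 'a \<Rightarrow> ('a \<Rightarrow> real) \<Rightarrow> real" where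
  "moment_map V x = (\<lambda>F\<in>V. F x)"

lemma moment_map_in_dual_space:
  assumes "finite_dimensional_subspace V"
  shows "moment_map V x \<in> dual_space V"
  using assms unfolding finite_dimensional_subspace_def dual_space_def moment_map_def by auto

definition NPH_stem ::
    "('a::topological_space, 'e::real_normed_vector) chart set \<Rightarrow>
      (('a, 'e) chart \<Rightarrow> 'a \<Rightarrow> 'e \<Rightarrow> 'e \<Rightarrow> real) \<Rightarrow> (('a \<Rightarrow> real) \<Rightarrow> real) \<Rightarrow> 'a set \<Rightarrow> bool" where
  "NPH_stem \<A> \<omega> \<zeta> X \<longleftrightarrow> closed X \<and>
     (\<exists>V. finite_dimensional_subspace V \<and> poisson_commutative \<A> \<omega> V \<and>
        (\<exists>p \<in> range (moment_map V). X = moment_map V -` {p}) \<and>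
        (\<forall>q \<in> dual_space V. moment_map V -` {q} \<noteq> {} \<and> moment_map V -` {q} \<noteq> X \<longrightarrow>
           \<not> pseudoheavy \<zeta> (moment_map V -` {q})))"

end

theory Submission
  imports Defs
begin

text \<open>
  Let \<open>X\<close> be a fibre of the moment map \<open>\<Phi>\<close> such that all other fibres are light, that is, not
  pseudoheavy, and let \<open>c\<close> be a real number with \<open>H < c\<close> on \<open>X\<close>. It has to be seen that
  \<open>\<zeta>(H) \<le> c\<close>. The set \<open>K = {H \<ge> c}\<close> is compact and misses \<open>X\<close>, so it only meets light fibres. A light
  fibre has a neighbourhood \<open>U\<close> such that \<open>\<zeta>\<close> is at most \<open>0\<close> on functions supported in \<open>U\<close>. As \<open>M\<close> is
  compact, \<open>U\<close> contains the preimage under \<open>\<Phi>\<close> of a neighbourhood of a point, and so some nonnegative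
  \<open>u \<circ> \<Phi>\<close> that is positive on the fibre has support in \<open>U\<close>
  (\<open>bump_function_of_light_fiber\<close>). Finitely many such bumps have a sum \<open>S \<circ> \<Phi>\<close> that is positive
  on \<open>K\<close>, and then \<open>H - c \<le> C \<cdot> (S \<circ> \<Phi>)\<close> for a large constant \<open>C\<close>. If \<open>\<zeta>\<close> is subadditive on the
  bumps, then \<open>\<zeta>(S \<circ> \<Phi>) \<le> 0\<close>, and \<open>\<zeta>(H) \<le> c\<close> follows from stability and semi-homogeneity
  (\<open>quasi_state_le_of_light_fibers\<close>).

  Quasi-subadditivity is only given for smooth commuting functions, while the bumps are merely
  continuous functions of \<open>\<Phi>\<close>. However, stability makes \<open>\<zeta>\<close> Lipschitz for the uniform norm, and by
  the Stone-Weierstrass theorem on \<open>\<Phi>(M)\<close> every continuous function of \<open>\<Phi>\<close> is a uniform limit of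
  polynomials in the components of \<open>\<Phi>\<close>. These polynomials are smooth, and they Poisson-commute
  by the Leibniz rule. So \<open>\<zeta>\<close> is subadditive on all continuous functions of \<open>\<Phi>\<close>
  (\<open>subadditive_pullback\<close>), and smooth cutoff functions and the chain rule can be avoided.
\<close>


section \<open>Smooth functions form an algebra\<close>

text \<open>Iterated derivatives on an open set only see the values there. This lets the sum and product rules,
  which hold on \<open>S\<close> only, be substituted under further derivatives.\<close>
lemma higher_differentiable_on_cong:
  assumes "open S" "\<And>x. x \<in> S \<Longrightarrow> f x = g x"
  shows "higher_differentiable_on S f n \<longleftrightarrow> higher_differentiable_on S g n"
  using assms(2)
proof (induction n arbitrary: f g)
  case 0
  then show ?case by (simp cong: continuous_on_cong)
next
  case (Suc n)
  have diff: "f differentiable (at x) \<longleftrightarrow> g differentiable (at x)" if "x \<in> S" for x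
  proof -
    have "\<And>y. y \<in> S \<Longrightarrow> g y = f y" using Suc.prems by simp
    then show ?thesis
      unfolding differentiable_def
      using has_derivative_transform_within_open[OF _ assms(1) that] Suc.prems by blast
  qed
  show ?case
  proof (cases "\<forall>x\<in>S. f differentiable (at x)")
    case True
    have "frechet_derivative f (at x) v = frechet_derivative g (at x) v" if "x \<in> S" for x v
      using frechet_derivative_transform_within_open[of f x S g] True Suc.prems assms(1) that by auto
    then have "higher_differentiable_on S (\<lambda>x. frechet_derivative f (at x) v) n
        \<longleftrightarrow> higher_differentiable_on S (\<lambda>x. frechet_derivative g (at x) v) n" for v
      by (rule Suc.IH)
    then show ?thesis using diff by simp
  next
    case False
    then show ?thesis using diff by auto
  qed
qed

text \<open>In the product rule the undifferentiated factors occur next to derivatives, so they are needed at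
  the lower order of differentiability.\<close>
lemma higher_differentiable_on_SucD:
  "higher_differentiable_on S f (Suc n) \<Longrightarrow> higher_differentiable_on S f n"
proof (induction n arbitrary: f)
  case 0
  then show ?case
    by (auto intro!: differentiable_imp_continuous_on differentiable_at_imp_differentiable_on)
next
  case (Suc n)
  show ?case
    unfolding higher_differentiable_on.simps(2)[of S f n]
    using Suc.prems unfolding higher_differentiable_on.simps(2)[of S f "Suc n"]
    by (blast intro: Suc.IH)
qed

lemma higher_differentiable_on_const: "higher_differentiable_on S (\<lambda>_. a) n"
  by (induction n arbitrary: a) auto

lemma higher_differentiable_on_add:
  assumes "open S" "higher_differentiable_on S f n" "higher_differentiable_on S g n"
  shows "higher_differentiable_on S (\<lambda>x. f x + g x) n"
  using assms(2,3)
proof (induction n arbitrary: f g)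
  case 0
  then show ?case by (simp add: continuous_on_add)
next
  case (Suc n)
  have deriv: "frechet_derivative (\<lambda>x. f x + g x) (at x) v
      = frechet_derivative f (at x) v + frechet_derivative g (at x) v" if "x \<in> S" for x v
  proof -
    have "(f has_derivative frechet_derivative f (at x)) (at x)"
      "(g has_derivative frechet_derivative g (at x)) (at x)"
      using Suc.prems that by (auto simp: frechet_derivative_works[symmetric])
    from frechet_derivative_at[OF has_derivative_add[OF this], symmetric] show ?thesis by simp
  qed
  show ?case
    using Suc higher_differentiable_on_cong[OF assms(1) deriv] by simp
qed

lemma higher_differentiable_on_mult:
  fixes f g :: "'e::real_normed_vector \<Rightarrow> real"
  assumes "open S" "higher_differentiable_on S f n" "higher_differentiable_on S g n"
  shows "higher_differentiable_on S (\<lambda>x. f x * g x) n"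
  using assms(2,3)
proof (induction n arbitrary: f g)
  case 0
  then show ?case by (simp add: continuous_on_mult)
next
  case (Suc n)
  have deriv: "frechet_derivative (\<lambda>x. f x * g x) (at x) v
      = f x * frechet_derivative g (at x) v + frechet_derivative f (at x) v * g x" if "x \<in> S" for x v
  proof -
    have "(f has_derivative frechet_derivative f (at x)) (at x)"
      "(g has_derivative frechet_derivative g (at x)) (at x)"
      using Suc.prems that by (auto simp: frechet_derivative_works[symmetric])
    from frechet_derivative_at[OF has_derivative_mult[OF this], symmetric] show ?thesis by simp
  qed
  have "higher_differentiable_on S f n" "higher_differentiable_on S g n"
    using Suc.prems higher_differentiable_on_SucD by blast+
  then have "higher_differentiable_on S
      (\<lambda>x. f x * frechet_derivative g (at x) v + frechet_derivative f (at x) v * g x) n" for v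
    using Suc.prems by (intro higher_differentiable_on_add assms(1) Suc.IH) auto
  then show ?case
    using Suc.prems higher_differentiable_on_cong[OF assms(1) deriv] by simp
qed

context smooth_manifold
begin

lemma smooth_functions_const: "(\<lambda>_. a) \<in> smooth_functions \<A>"
  by (auto simp: smooth_functions_def smooth_on_def comp_def higher_differentiable_on_const)

lemma smooth_functions_add:
  "f \<in> smooth_functions \<A> \<Longrightarrow> g \<in> smooth_functions \<A> \<Longrightarrow> (\<lambda>x. f x + g x) \<in> smooth_functions \<A>"
  using open_img by (auto simp: smooth_functions_def smooth_on_def comp_def intro: higher_differentiable_on_add)

lemma smooth_functions_mult:
  "f \<in> smooth_functions \<A> \<Longrightarrow> g \<in> smooth_functions \<A> \<Longrightarrow> (\<lambda>x. f x * g x) \<in> smooth_functions \<A>"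
  using open_img by (auto simp: smooth_functions_def smooth_on_def comp_def intro: higher_differentiable_on_mult)

lemma inv_chart_coord: "c \<in> \<A> \<Longrightarrow> x \<in> dom_chart c \<Longrightarrow> inv_chart c (coord c x) = x"
  using homeo by (auto simp: homeomorphism_def)

lemma smooth_functions_continuous:
  assumes "f \<in> smooth_functions \<A>"
  shows "continuous_on UNIV f"
proof -
  have "continuous_on (\<Union>c\<in>\<A>. dom_chart c) f"
  proof (rule continuous_on_open_UN)
    fix c assume c: "c \<in> \<A>"
    have "higher_differentiable_on (img_chart c) (f \<circ> inv_chart c) 0"
      using assms c by (simp only: smooth_functions_def smooth_on_def) blast
    then have "continuous_on (img_chart c) (f \<circ> inv_chart c)"
      by simp
    moreover have "continuous_on (dom_chart c) (coord c)" "coord c ` dom_chart c = img_chart c"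
      using homeo[OF c] by (auto simp: homeomorphism_def)
    ultimately have "continuous_on (dom_chart c) ((f \<circ> inv_chart c) \<circ> coord c)"
      by (metis continuous_on_compose)
    then show "continuous_on (dom_chart c) f"
      using inv_chart_coord[OF c] by (simp cong: continuous_on_cong)
  qed (use open_dom in auto)
  then show ?thesis by (simp add: covers)
qed

lemma smooth_functions_has_derivative:
  assumes "f \<in> smooth_functions \<A>" "c \<in> \<A>" "x \<in> dom_chart c"
  shows "((f \<circ> inv_chart c) has_derivative diff_chart c f x) (at (coord c x))"
proof -
  have "higher_differentiable_on (img_chart c) (f \<circ> inv_chart c) (Suc 0)"
    using assms(1,2) by (simp only: smooth_functions_def smooth_on_def) blast
  moreover have "coord c x \<in> img_chart c"
    using assms(3) by (simp add: img_chart_def)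
  ultimately show ?thesis
    by (simp add: diff_chart_def frechet_derivative_works)
qed

lemma diff_chart_const: "diff_chart c (\<lambda>_. a) x v = 0"
  by (simp add: diff_chart_def comp_def)

lemma diff_chart_add:
  assumes "f \<in> smooth_functions \<A>" "g \<in> smooth_functions \<A>" "c \<in> \<A>" "x \<in> dom_chart c"
  shows "diff_chart c (\<lambda>x. f x + g x) x v = diff_chart c f x v + diff_chart c g x v"
  using frechet_derivative_at[OF has_derivative_add[OF smooth_functions_has_derivative[OF assms(1,3,4)]
        smooth_functions_has_derivative[OF assms(2,3,4)]], symmetric]
  by (simp add: diff_chart_def comp_def)

lemma diff_chart_mult:
  assumes "f \<in> smooth_functions \<A>" "g \<in> smooth_functions \<A>" "c \<in> \<A>" "x \<in> dom_chart c"
  shows "diff_chart c (\<lambda>x. f x * g x) x v = f x * diff_chart c g x v + diff_chart c f x v * g x"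
  using frechet_derivative_at[OF has_derivative_mult[OF smooth_functions_has_derivative[OF assms(1,3,4)]
        smooth_functions_has_derivative[OF assms(2,3,4)]], symmetric] inv_chart_coord[OF assms(3,4)]
  by (simp add: diff_chart_def comp_def)

end


section \<open>Poisson-commuting algebras\<close>

text \<open>A Hamiltonian vector field is defined by a definite description, so it satisfies its equation only
  once existence and uniqueness are known. Uniqueness is nondegeneracy; existence is a dimension
  count, as an injective linear map from \<open>'e\<close> to its dual is onto.\<close>
lemma nondegenerate_bilinear_represents_unique:
  fixes \<beta> :: "'e::real_normed_vector \<Rightarrow> 'e \<Rightarrow> real"
  assumes "bilinear \<beta>" and nondeg: "\<And>v. (\<forall>w. \<beta> v w = 0) \<Longrightarrow> v = 0"
    and fin: "\<exists>B :: 'e set. finite B \<and> span B = UNIV"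
    and l: "linear l"
  shows "\<exists>!X. \<forall>w. \<beta> X w = l w"
proof -
  from fin obtain C :: "'e set" where C: "finite C" "span C = UNIV" by blast
  obtain B where B: "B \<subseteq> C" "independent B" "C \<subseteq> span B"
    using maximal_independent_subset by blast
  have finB: "finite B" using B C finite_subset by blast
  have spanB: "span B = UNIV" using B(3) C(2) span_minimal[OF B(3)] by auto
  interpret B: finite_dimensional_vector_space_pair scaleR B scaleR B
    by unfold_locales (use B finB spanB in \<open>auto simp: dependent_raw_def span_raw_def algebra_simps\<close>)
  have lin2: "linear (\<beta> v)" and lin1: "linear (\<lambda>v. \<beta> v w)" for v w
    using assms(1) by (auto simp: bilinear_def)
  have eqI: "\<beta> u = l'" if "linear l'" "\<And>b. b \<in> B \<Longrightarrow> \<beta> u b = l' b" for u and l' :: "'e \<Rightarrow> real"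
    using linear_eq_on_span[OF lin2 that(1) that(2)] spanB by blast
  \<comment> \<open>\<open>T\<close> is \<open>v \<mapsto> \<beta> v\<close>, with the dual space identified with \<open>'e\<close> through the basis \<open>B\<close>.\<close>
  define T where "T v = (\<Sum>b\<in>B. \<beta> v b *\<^sub>R b)" for v
  have linT: "linear T"
    unfolding T_def
    by (intro linear_compose_sum ballI linearI)
      (simp_all add: bilinear_ladd[OF assms(1)] bilinear_lmul[OF assms(1)] scaleR_left_distrib)
  have coeff: "\<forall>b\<in>B. a b = a' b" if "(\<Sum>b\<in>B. a b *\<^sub>R b) = (\<Sum>b\<in>B. a' b *\<^sub>R b)" for a a' :: "'e \<Rightarrow> real"
  proof -
    have "(\<Sum>b\<in>B. (a b - a' b) *\<^sub>R b) = 0"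
      using that by (simp add: scaleR_left_diff_distrib sum_subtractf)
    then show ?thesis using independentD[OF B(2) finB subset_refl] by fastforce
  qed
  have "inj T"
  proof (subst linear_injective_0[OF linT], intro allI impI)
    fix v assume "T v = 0"
    then have "\<forall>b\<in>B. \<beta> v b = 0"
      using coeff[of "\<beta> v" "\<lambda>_. 0"] by (simp add: T_def)
    then have "\<beta> v = (\<lambda>_. 0)"
      by (intro eqI) (auto intro: linear_zero)
    then show "v = 0" by (intro nondeg) simp
  qed
  have "surj T"
    using B.linear_injective_imp_surjective linT \<open>inj T\<close> by (simp add: linear_def)
  then obtain X where "T X = (\<Sum>b\<in>B. l b *\<^sub>R b)" by (metis surjD)
  then have "\<forall>b\<in>B. \<beta> X b = l b" using coeff by (simp add: T_def)
  then have X: "\<beta> X = l" by (intro eqI l) auto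
  have "Y = X" if "\<forall>w. \<beta> Y w = l w" for Y
  proof -
    have "\<beta> (Y - X) w = 0" for w
      using that X linear_diff[OF lin1] by simp
    then show ?thesis using nondeg by fastforce
  qed
  then show ?thesis using X by metis
qed

context closed_symplectic_manifold
begin

lemma ham_vector_field:
  assumes "f \<in> smooth_functions \<A>" "c \<in> \<A>" "x \<in> dom_chart c"
  shows "\<omega> c x (ham_vector_field \<omega> c f x) w = - diff_chart c f x w"
proof -
  have "linear (\<lambda>w. - diff_chart c f x w)"
    using has_derivative_linear[OF smooth_functions_has_derivative[OF assms]]
    by (rule linear_compose_neg)
  then have "\<exists>!X. \<forall>w. \<omega> c x X w = - diff_chart c f x w"
    using assms nondegenerate bilinear finite_dimensional
    by (intro nondegenerate_bilinear_represents_unique) auto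
  from theI'[OF this] show ?thesis unfolding ham_vector_field_def by blast
qed

lemma antisymmetric:
  assumes "c \<in> \<A>" "x \<in> dom_chart c"
  shows "\<omega> c x v w = - \<omega> c x w v"
proof -
  note b = bilinear[OF assms]
  have "\<omega> c x (v + w) (v + w) = 0" "\<omega> c x v v = 0" "\<omega> c x w w = 0"
    using alternating assms by auto
  then show ?thesis
    by (simp add: bilinear_ladd[OF b] bilinear_radd[OF b])
qed

text \<open>In this form \<open>{f, g}\<close> is a derivation in \<open>f\<close>. Hence the functions commuting with a fixed
  \<open>g\<close> form an algebra, which is the content of the closure lemmas below.\<close>
lemma poisson_bracket_eq:
  assumes "f \<in> smooth_functions \<A>" "c \<in> \<A>" "x \<in> dom_chart c"
  shows "poisson_bracket \<omega> c f g x = diff_chart c f x (ham_vector_field \<omega> c g x)"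
  unfolding poisson_bracket_def
  by (subst antisymmetric[OF assms(2,3)]) (simp add: ham_vector_field[OF assms])

lemma poisson_commute_sym: "poisson_commute \<A> \<omega> f g \<Longrightarrow> poisson_commute \<A> \<omega> g f"
  unfolding poisson_commute_def poisson_bracket_def
  by (metis antisymmetric neg_equal_0_iff_equal)

lemma poisson_commute_const: "poisson_commute \<A> \<omega> (\<lambda>_. a) g"
  by (simp add: poisson_commute_def poisson_bracket_eq smooth_functions_const diff_chart_const)

lemma poisson_commute_add:
  assumes "f \<in> smooth_functions \<A>" "f' \<in> smooth_functions \<A>"
    and "poisson_commute \<A> \<omega> f g" "poisson_commute \<A> \<omega> f' g"
  shows "poisson_commute \<A> \<omega> (\<lambda>x. f x + f' x) g"
  using assms by (simp add: poisson_commute_def poisson_bracket_eq smooth_functions_add diff_chart_add)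

lemma poisson_commute_mult:
  assumes "f \<in> smooth_functions \<A>" "f' \<in> smooth_functions \<A>"
    and "poisson_commute \<A> \<omega> f g" "poisson_commute \<A> \<omega> f' g"
  shows "poisson_commute \<A> \<omega> (\<lambda>x. f x * f' x) g"
  using assms by (simp add: poisson_commute_def poisson_bracket_eq smooth_functions_mult diff_chart_mult)

end

inductive_set generated_algebra :: "('a \<Rightarrow> real) set \<Rightarrow> ('a \<Rightarrow> real) set" for V where
  generator: "F \<in> V \<Longrightarrow> F \<in> generated_algebra V"
| const: "(\<lambda>_. a) \<in> generated_algebra V"
| add: "F \<in> generated_algebra V \<Longrightarrow> G \<in> generated_algebra V \<Longrightarrow> (\<lambda>x. F x + G x) \<in> generated_algebra V"
| mult: "F \<in> generated_algebra V \<Longrightarrow> G \<in> generated_algebra V \<Longrightarrow> (\<lambda>x. F x * G x) \<in> generated_algebra V"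

lemma (in smooth_manifold) generated_algebra_smooth:
  assumes "V \<subseteq> smooth_functions \<A>" "F \<in> generated_algebra V"
  shows "F \<in> smooth_functions \<A>"
  using assms(2)
  by induction (use assms(1) in \<open>auto intro: smooth_functions_const smooth_functions_add smooth_functions_mult\<close>)

text \<open>By the Leibniz rule, what commutes with a fixed function is an algebra. So the algebra
  commutes with each generator, and then, by symmetry of commutation, with itself.\<close>
lemma (in closed_symplectic_manifold) generated_algebra_poisson_commutative:
  assumes V: "poisson_commutative \<A> \<omega> V"
  shows "poisson_commutative \<A> \<omega> (generated_algebra V)"
proof -
  have smooth: "V \<subseteq> smooth_functions \<A>" using V by (simp add: poisson_commutative_def)
  note smooth_alg = generated_algebra_smooth[OF smooth]
  have one: "poisson_commute \<A> \<omega> F G" if "F \<in> generated_algebra V" "G \<in> V" for F G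
    using that(1)
    by induction (use V that(2) in \<open>auto simp: poisson_commutative_def intro: smooth_alg
        poisson_commute_const poisson_commute_add poisson_commute_mult\<close>)
  have "poisson_commute \<A> \<omega> F G" if "F \<in> generated_algebra V" "G \<in> generated_algebra V" for F G
    using that(1)
    by induction (use that(2) in \<open>auto intro: poisson_commute_sym[OF one] smooth_alg
        poisson_commute_const poisson_commute_add poisson_commute_mult\<close>)
  then show ?thesis using smooth_alg by (auto simp: poisson_commutative_def)
qed


section \<open>Quasi-states on functions of a moment map\<close>

context partial_symplectic_quasi_state
begin

lemma quasi_state_lipschitz:
  assumes "f \<in> continuous_functions" "g \<in> continuous_functions" "\<And>x. f x \<le> g x + e"
  shows "\<zeta> f \<le> \<zeta> g + e"
proof -
  have "(SUP x. f x - g x) \<le> e"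
    using assms(3) by (intro cSUP_least) (auto simp: algebra_simps)
  then show ?thesis using stability[OF assms(1,2)] by linarith
qed

end

text \<open>The moment map in coordinates: a sequence of commuting functions \<open>F i\<close> stands for a spanning set of
  the commutative space. Then \<open>\<Phi>\<close> takes values in the metrizable space \<open>\<nat> \<rightarrow> \<real>\<close> instead of the
  dual space, but it has the same fibres as the moment map.\<close>
locale commuting_moment_map = partial_symplectic_quasi_state \<A> \<omega> \<zeta>
  for \<A> :: "('a::{t2_space, second_countable_topology}, 'e::real_normed_vector) chart set"
    and \<omega> \<zeta> +
  fixes F :: "nat \<Rightarrow> 'a \<Rightarrow> real"
  assumes commutative: "poisson_commutative \<A> \<omega> (range F)"
begin

definition \<Phi> :: "'a \<Rightarrow> nat \<Rightarrow> real" where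
  "\<Phi> x = (\<lambda>i. F i x)"

lemma continuous_moment_map: "continuous_on UNIV \<Phi>"
proof (rule continuous_on_coordinatewise_then_product)
  fix i
  show "continuous_on UNIV (\<lambda>x. \<Phi> x i)"
    using commutative smooth_functions_continuous[of "F i"]
    by (auto simp: \<Phi>_def poisson_commutative_def)
qed

lemma compact_range_moment_map: "compact (range \<Phi>)"
  using compact_continuous_image[OF continuous_moment_map compact_manifold] .

text \<open>The setting of the Stone-Weierstrass theorem: polynomials in the coordinates, restricted to the
  compact set \<open>\<Phi>(M)\<close>. The coordinates separate the points.\<close>
sublocale function_ring_on "{u. u \<circ> \<Phi> \<in> generated_algebra (range F) \<and> continuous_on (range \<Phi>) u}" "range \<Phi>"
proof
  show "compact (range \<Phi>)" by (rule compact_range_moment_map)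
next
  fix p q :: "nat \<Rightarrow> real" assume "p \<noteq> q"
  then obtain i where "p i \<noteq> q i" by blast
  moreover have "(\<lambda>l. l i) \<circ> \<Phi> = F i"
    by (auto simp: \<Phi>_def)
  ultimately show "\<exists>u\<in>{u. u \<circ> \<Phi> \<in> generated_algebra (range F) \<and> continuous_on (range \<Phi>) u}. u p \<noteq> u q"
    by (intro bexI[of _ "\<lambda>l. l i"])
      (auto intro: generated_algebra.generator continuous_on_subset[OF continuous_on_product_coordinates])
qed (auto simp: comp_def intro: generated_algebra.intros continuous_intros)

lemma continuous_pullback: "continuous_on (range \<Phi>) u \<Longrightarrow> u \<circ> \<Phi> \<in> continuous_functions"
  using continuous_on_compose[OF continuous_moment_map] by (simp add: continuous_functions_def)

text \<open>Approximating \<open>u\<close> and \<open>v\<close> by polynomials in the coordinates reduces the claim to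
  quasi-subadditivity, since \<open>\<zeta>\<close> is continuous for uniform convergence.\<close>
lemma subadditive_pullback:
  assumes u: "continuous_on (range \<Phi>) u" and v: "continuous_on (range \<Phi>) v"
  shows "\<zeta> (\<lambda>x. u (\<Phi> x) + v (\<Phi> x)) \<le> \<zeta> (u \<circ> \<Phi>) + \<zeta> (v \<circ> \<Phi>)"
proof (rule field_le_epsilon)
  fix e :: real assume "e > 0"
  \<comment> \<open>Each of \<open>u\<close> and \<open>v\<close> is replaced once on either side of the inequality, hence four errors.\<close>
  then have e: "e / 4 > 0" by simp
  obtain u' where u': "u' \<circ> \<Phi> \<in> generated_algebra (range F)" "continuous_on (range \<Phi>) u'"
      "\<And>x. \<bar>u (\<Phi> x) - u' (\<Phi> x)\<bar> < e / 4"
    using Stone_Weierstrass_basic[OF u e] by auto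
  obtain v' where v': "v' \<circ> \<Phi> \<in> generated_algebra (range F)" "continuous_on (range \<Phi>) v'"
      "\<And>x. \<bar>v (\<Phi> x) - v' (\<Phi> x)\<bar> < e / 4"
    using Stone_Weierstrass_basic[OF v e] by auto
  have sum: "(\<lambda>x. u (\<Phi> x) + v (\<Phi> x)) \<in> continuous_functions" "(\<lambda>x. u' (\<Phi> x) + v' (\<Phi> x)) \<in> continuous_functions"
    using continuous_pullback[OF continuous_on_add[OF u v]]
      continuous_pullback[OF continuous_on_add[OF u'(2) v'(2)]] by (simp_all add: comp_def)
  have "\<zeta> (\<lambda>x. u (\<Phi> x) + v (\<Phi> x)) \<le> \<zeta> (\<lambda>x. u' (\<Phi> x) + v' (\<Phi> x)) + e / 2"
  proof (rule quasi_state_lipschitz[OF sum])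
    show "u (\<Phi> x) + v (\<Phi> x) \<le> u' (\<Phi> x) + v' (\<Phi> x) + e / 2" for x
      using u'(3)[of x] v'(3)[of x] by linarith
  qed
  moreover have "\<zeta> (\<lambda>x. u' (\<Phi> x) + v' (\<Phi> x)) \<le> \<zeta> (u' \<circ> \<Phi>) + \<zeta> (v' \<circ> \<Phi>)"
    using quasi_subadditivity[of "u' \<circ> \<Phi>" "v' \<circ> \<Phi>"] u'(1) v'(1)
      generated_algebra_poisson_commutative[OF commutative]
    by (auto simp: poisson_commutative_def)
  moreover have "\<zeta> (u' \<circ> \<Phi>) \<le> \<zeta> (u \<circ> \<Phi>) + e / 4"
  proof (rule quasi_state_lipschitz)
    show "(u' \<circ> \<Phi>) x \<le> (u \<circ> \<Phi>) x + e / 4" for x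
      using u'(3)[of x] unfolding comp_def by linarith
  qed (use continuous_pullback u u' in auto)
  moreover have "\<zeta> (v' \<circ> \<Phi>) \<le> \<zeta> (v \<circ> \<Phi>) + e / 4"
  proof (rule quasi_state_lipschitz)
    show "(v' \<circ> \<Phi>) x \<le> (v \<circ> \<Phi>) x + e / 4" for x
      using v'(3)[of x] unfolding comp_def by linarith
  qed (use continuous_pullback v v' in auto)
  ultimately show "\<zeta> (\<lambda>x. u (\<Phi> x) + v (\<Phi> x)) \<le> \<zeta> (u \<circ> \<Phi>) + \<zeta> (v \<circ> \<Phi>) + e"
    by linarith
qed

lemma subadditive_pullback_sum:
  assumes "finite Q" "\<And>i. i \<in> Q \<Longrightarrow> continuous_on (range \<Phi>) (u i)"
  shows "\<zeta> (\<lambda>x. \<Sum>i\<in>Q. u i (\<Phi> x)) \<le> (\<Sum>i\<in>Q. \<zeta> (u i \<circ> \<Phi>))"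
  using assms
proof (induction Q)
  case empty
  then show ?case using normalization[of 0] by simp
next
  case (insert i Q)
  have "\<zeta> (\<lambda>x. u i (\<Phi> x) + (\<Sum>i\<in>Q. u i (\<Phi> x))) \<le> \<zeta> (u i \<circ> \<Phi>) + \<zeta> ((\<lambda>l. \<Sum>i\<in>Q. u i l) \<circ> \<Phi>)"
    using insert by (intro subadditive_pullback continuous_on_sum) auto
  then show ?case using insert by (simp add: comp_def)
qed

lemma closed_fiber: "closed (\<Phi> -` {q})"
  using closed_vimage[OF closed_singleton continuous_moment_map] .

text \<open>A neighbourhood \<open>U\<close> of the fibre contains the preimage of a neighbourhood of the point, because
  \<open>\<Phi>(M - U)\<close> is compact and misses the point. A bump around the point that vanishes near
  \<open>\<Phi>(M - U)\<close> pulls back to a function supported in \<open>U\<close>.\<close>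
lemma bump_function_of_light_fiber:
  assumes "\<not> pseudoheavy \<zeta> (\<Phi> -` {\<Phi> y})"
  obtains u where "continuous_on (range \<Phi>) u" "\<And>l. u l \<ge> 0" "u (\<Phi> y) > 0" "\<zeta> (u \<circ> \<Phi>) \<le> 0"
proof -
  obtain U where U: "open U" "\<Phi> -` {\<Phi> y} \<subseteq> U" "\<And>F. F \<in> supported_functions U \<Longrightarrow> \<zeta> F \<le> 0"
    using assms closed_fiber by (force simp: pseudoheavy_def not_less)
  have "compact (\<Phi> ` (- U))"
    using compact_Int_closed[OF compact_manifold, of "- U"] U(1)
      continuous_on_subset[OF continuous_moment_map, of "- U"]
    by (intro compact_continuous_image) (auto simp: closed_Compl)
  then have "closed (\<Phi> ` (- U))" by (rule compact_imp_closed)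
  moreover have "\<Phi> ` (- U) \<inter> {\<Phi> y} = {}" using U(2) by auto
  moreover have "\<Phi> ` (- U) \<subseteq> range \<Phi>" by blast
  ultimately obtain f :: "(nat \<Rightarrow> real) \<Rightarrow> real" where f: "continuous_on (range \<Phi>) f"
      and "\<forall>l\<in>\<Phi> ` (- U). f l < 1 / 2" and "\<forall>l\<in>{\<Phi> y}. f l > 1 - 1 / 2"
    using two[of "\<Phi> ` (- U)" "{\<Phi> y}" "1 / 2"] by auto
  then have f_less: "\<And>x. x \<notin> U \<Longrightarrow> f (\<Phi> x) < 1 / 2" and f_greater: "f (\<Phi> y) > 1 / 2"
    by auto
  \<comment> \<open>Cutting off at the level that separates \<open>\<Phi>(M - U)\<close> from \<open>\<Phi>(y)\<close> makes the support small:
    it lies in the closed set \<open>f \<circ> \<Phi> \<ge> 1/2\<close>, not merely in the closure of \<open>U\<close>.\<close>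
  define u where "u l = max 0 (f l - 1 / 2)" for l
  have contu: "continuous_on (range \<Phi>) u"
    unfolding u_def by (intro continuous_intros f)
  have "{x. (u \<circ> \<Phi>) x \<noteq> 0} \<subseteq> {x. 1 / 2 \<le> (f \<circ> \<Phi>) x}"
    by (auto simp: u_def max_def split: if_splits)
  moreover have "closed {x. 1 / 2 \<le> (f \<circ> \<Phi>) x}"
    using continuous_pullback[OF f]
    by (intro closed_Collect_le) (auto simp: continuous_functions_def)
  ultimately have "supp (u \<circ> \<Phi>) \<subseteq> {x. 1 / 2 \<le> (f \<circ> \<Phi>) x}"
    unfolding supp_def by (rule closure_minimal)
  also have "\<dots> \<subseteq> U" using f_less by force
  finally have "u \<circ> \<Phi> \<in> supported_functions U"
    using continuous_pullback[OF contu] by (simp add: supported_functions_def)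
  then show thesis
    using that[of u] contu f_greater U(3) by (auto simp: u_def)
qed

text \<open>On the set \<open>H \<ge> c\<close>, a multiple of a finite sum of bumps around light fibres dominates
  \<open>H - c\<close>, and \<open>\<zeta>\<close> of such a sum is at most \<open>0\<close>.\<close>
theorem quasi_state_le_of_light_fibers:
  assumes H: "H \<in> continuous_functions"
    and light: "\<And>y. H y \<ge> c \<Longrightarrow> \<not> pseudoheavy \<zeta> (\<Phi> -` {\<Phi> y})"
  shows "\<zeta> H \<le> c"
proof -
  define K where "K = {y. c \<le> H y}"
  have contH: "continuous_on UNIV H" using H by (simp add: continuous_functions_def)
  have "closed K"
    unfolding K_def using contH by (intro closed_Collect_le) auto
  then have "compact K"
    using compact_Int_closed[OF compact_manifold] by simp
  have "\<forall>y\<in>K. \<exists>u. continuous_on (range \<Phi>) u \<and> (\<forall>l. u l \<ge> 0) \<and> u (\<Phi> y) > 0 \<and> \<zeta> (u \<circ> \<Phi>) \<le> 0"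
  proof
    fix y assume "y \<in> K"
    then have "\<not> pseudoheavy \<zeta> (\<Phi> -` {\<Phi> y})" by (intro light) (simp add: K_def)
    from bump_function_of_light_fiber[OF this]
    show "\<exists>u. continuous_on (range \<Phi>) u \<and> (\<forall>l. u l \<ge> 0) \<and> u (\<Phi> y) > 0 \<and> \<zeta> (u \<circ> \<Phi>) \<le> 0"
      by blast
  qed
  from bchoice[OF this] obtain u where "\<forall>y\<in>K. continuous_on (range \<Phi>) (u y) \<and> (\<forall>l. u y l \<ge> 0) \<and>
      u y (\<Phi> y) > 0 \<and> \<zeta> (u y \<circ> \<Phi>) \<le> 0" ..
  then have u: "\<And>y. y \<in> K \<Longrightarrow> continuous_on (range \<Phi>) (u y)" "\<And>y l. y \<in> K \<Longrightarrow> u y l \<ge> 0"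
      "\<And>y. y \<in> K \<Longrightarrow> u y (\<Phi> y) > 0" "\<And>y. y \<in> K \<Longrightarrow> \<zeta> (u y \<circ> \<Phi>) \<le> 0"
    by simp_all
  have contu: "continuous_on UNIV (\<lambda>x. u y (\<Phi> x))" if "y \<in> K" for y
    using continuous_pullback[OF u(1)[OF that]] by (simp add: continuous_functions_def comp_def)
  have "open {x. 0 < u y (\<Phi> x)}" if "y \<in> K" for y
    using contu[OF that] by (intro open_Collect_less) auto
  moreover have "K \<subseteq> (\<Union>y\<in>K. {x. 0 < u y (\<Phi> x)})"
    using u(3) by auto
  ultimately obtain Q where Q: "Q \<subseteq> K" "finite Q" "K \<subseteq> (\<Union>y\<in>Q. {x. 0 < u y (\<Phi> x)})"
    by (rule compactE_image[OF \<open>compact K\<close>])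
  define S where "S l = (\<Sum>y\<in>Q. u y l)" for l
  have contS: "continuous_on (range \<Phi>) S"
    unfolding S_def using Q u(1) by (intro continuous_on_sum) auto
  have contS': "continuous_on UNIV (\<lambda>x. S (\<Phi> x))"
    using continuous_pullback[OF contS] by (simp add: continuous_functions_def comp_def)
  have S_nonneg: "S l \<ge> 0" for l
    unfolding S_def using Q u(2) by (intro sum_nonneg) auto
  have S_pos: "S (\<Phi> x) > 0" if x: "x \<in> K" for x
  proof -
    obtain y where "y \<in> Q" "0 < u y (\<Phi> x)" using Q x by blast
    then show ?thesis
      unfolding S_def using Q u(2) by (intro sum_pos2[of _ y]) auto
  qed
  obtain C where C: "C > 0" "\<And>x. x \<in> K \<Longrightarrow> (H x - c) / S (\<Phi> x) \<le> C"
  proof -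
    have "continuous_on K (\<lambda>x. (H x - c) / S (\<Phi> x))"
    proof (intro continuous_on_divide continuous_on_diff continuous_on_const ballI)
      show "continuous_on K H" "continuous_on K (\<lambda>x. S (\<Phi> x))"
        by (rule continuous_on_subset[OF contH subset_UNIV] continuous_on_subset[OF contS' subset_UNIV])+
      show "S (\<Phi> x) \<noteq> 0" if "x \<in> K" for x using S_pos[OF that] by simp
    qed
    then have "bounded ((\<lambda>x. (H x - c) / S (\<Phi> x)) ` K)"
      using \<open>compact K\<close> by (intro compact_imp_bounded compact_continuous_image)
    then obtain C where "C > 0" "\<forall>x\<in>K. \<bar>(H x - c) / S (\<Phi> x)\<bar> \<le> C"
      unfolding bounded_pos by auto
    then show thesis by (intro that[of C]) (auto intro: abs_le_D1 simp del: abs_divide)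
  qed
  have "\<zeta> H \<le> \<zeta> (\<lambda>x. C * S (\<Phi> x)) + c"
  proof (rule quasi_state_lipschitz[OF H])
    show "(\<lambda>x. C * S (\<Phi> x)) \<in> continuous_functions"
      using contS' by (simp add: continuous_functions_def continuous_on_mult_left)
    show "H x \<le> C * S (\<Phi> x) + c" for x
    proof (cases "x \<in> K")
      case True
      then show ?thesis using C(2)[OF True] S_pos[OF True] by (simp add: field_simps)
    next
      case False
      then show ?thesis
        using mult_nonneg_nonneg[of C "S (\<Phi> x)"] C(1) S_nonneg by (simp add: K_def not_le add_increasing)
    qed
  qed
  also have "\<zeta> (\<lambda>x. C * S (\<Phi> x)) = C * \<zeta> (\<lambda>x. S (\<Phi> x))"
    using contS' C(1) by (intro semi_homogeneity) (auto simp: continuous_functions_def)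
  also have "\<dots> + c \<le> c"
  proof -
    have "\<zeta> (\<lambda>x. S (\<Phi> x)) \<le> (\<Sum>y\<in>Q. \<zeta> (u y \<circ> \<Phi>))"
      unfolding S_def using Q u(1) by (intro subadditive_pullback_sum) auto
    also have "\<dots> \<le> 0"
      using Q u(4) by (intro sum_nonpos) auto
    finally show ?thesis
      using mult_nonneg_nonpos[of C "\<zeta> (\<lambda>x. S (\<Phi> x))"] C(1) by linarith
  qed
  finally show ?thesis .
qed

end

theorem theorem2p6:
  fixes \<A> :: "('a::{t2_space, second_countable_topology}, 'e::real_normed_vector) chart set"
    and \<omega> :: "('a, 'e) chart \<Rightarrow> 'a \<Rightarrow> 'e \<Rightarrow> 'e \<Rightarrow> real"
    and \<zeta> :: "('a \<Rightarrow> real) \<Rightarrow> real"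
    and X :: "'a set"
  assumes "closed_symplectic_manifold \<A> \<omega>"
    and "partial_symplectic_quasi_state \<A> \<omega> \<zeta>"
    and "NPH_stem \<A> \<omega> \<zeta> X"
  shows "superheavy \<zeta> X"
proof -
  obtain V p where V: "finite_dimensional_subspace V" "poisson_commutative \<A> \<omega> V"
    and X: "closed X" "X = moment_map V -` {p}"
    and light: "\<And>q. q \<in> dual_space V \<Longrightarrow> moment_map V -` {q} \<noteq> {} \<Longrightarrow> moment_map V -` {q} \<noteq> X
       \<Longrightarrow> \<not> pseudoheavy \<zeta> (moment_map V -` {q})"
    using assms(3) unfolding NPH_stem_def by (elim conjE exE bexE) (rule that, assumption+, simp)
  interpret partial_symplectic_quasi_state \<A> \<omega> \<zeta> by fact
  obtain B where B: "finite B" "B \<subseteq> V" "\<forall>G\<in>V. \<exists>a. G = (\<lambda>x. \<Sum>F\<in>B. a F * F x)"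
    using V(1) unfolding finite_dimensional_subspace_def by (elim conjE exE)
  \<comment> \<open>The zero function makes the family non-empty, so that it can be enumerated by a sequence.\<close>
  define F where "F = from_nat_into (insert (\<lambda>_. 0) B)"
  have rangeF: "range F = insert (\<lambda>_. 0) B"
    unfolding F_def using B(1) by (intro range_from_nat_into) (auto intro: countable_finite)
  have "range F \<subseteq> V"
    unfolding rangeF
  proof (rule insert_subsetI)
    show "(\<lambda>_. 0) \<in> V" using V(1) unfolding finite_dimensional_subspace_def by (rule conjunct1)
  qed (rule B(2))
  then have "poisson_commutative \<A> \<omega> (range F)"
    using V(2) unfolding poisson_commutative_def by blast
  then interpret commuting_moment_map \<A> \<omega> \<zeta> F by unfold_locales
  have same_fiber: "\<Phi> -` {\<Phi> y} = moment_map V -` {moment_map V y}" for y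
  proof -
    have "\<Phi> x = \<Phi> y \<longleftrightarrow> moment_map V x = moment_map V y" for x
    proof
      assume "\<Phi> x = \<Phi> y"
      then have "F i x = F i y" for i by (simp add: \<Phi>_def fun_eq_iff)
      then have "\<forall>f\<in>range F. f x = f y" by auto
      then have "\<forall>f\<in>B. f x = f y" by (simp add: rangeF)
      then have "\<forall>G\<in>V. G x = G y"
      proof (intro ballI)
        fix G assume "G \<in> V"
        then obtain a where "G = (\<lambda>x. \<Sum>F\<in>B. a F * F x)" using B(3) by blast
        moreover have "(\<Sum>F\<in>B. a F * F x) = (\<Sum>F\<in>B. a F * F y)"
          using \<open>\<forall>f\<in>B. f x = f y\<close> by (intro sum.cong refl arg_cong2[of _ _ _ _ times]) blast
        ultimately show "G x = G y" by simp
      qed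
      then show "moment_map V x = moment_map V y"
        by (auto simp: moment_map_def)
    next
      assume eq: "moment_map V x = moment_map V y"
      have "F i x = F i y" for i
      proof -
        have "F i \<in> V" using \<open>range F \<subseteq> V\<close> by blast
        then show ?thesis using fun_cong[OF eq, of "F i"] by (simp add: moment_map_def)
      qed
      then show "\<Phi> x = \<Phi> y" by (simp add: \<Phi>_def)
    qed
    then show ?thesis by auto
  qed
  have "ereal (\<zeta> H) \<le> (SUP x\<in>X. ereal (H x))" if H: "H \<in> continuous_functions" for H
  proof (rule ccontr)
    assume "\<not> ?thesis"
    \<comment> \<open>A level strictly between the supremum of \<open>H\<close> over \<open>X\<close> and \<open>\<zeta>(H)\<close>, so that \<open>H < c\<close> on all of \<open>X\<close>.\<close>
    then obtain c where c: "(SUP x\<in>X. ereal (H x)) < ereal c" "c < \<zeta> H"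
      using ereal_dense2[of "SUP x\<in>X. ereal (H x)" "ereal (\<zeta> H)"] by (auto simp: not_le)
    have "\<not> pseudoheavy \<zeta> (\<Phi> -` {\<Phi> y})" if "H y \<ge> c" for y
      unfolding same_fiber
    proof (rule light)
      show "moment_map V y \<in> dual_space V" by (rule moment_map_in_dual_space[OF V(1)])
      have "ereal (H x) < ereal c" if "x \<in> X" for x
        using c(1) SUP_upper[OF that, of "\<lambda>x. ereal (H x)"] by (rule le_less_trans[rotated])
      from this[of y] have "y \<notin> X" using \<open>H y \<ge> c\<close> by auto
      then show "moment_map V -` {moment_map V y} \<noteq> X" by blast
    qed auto
    then have "\<zeta> H \<le> c" by (rule quasi_state_le_of_light_fibers[OF H])
    with c(2) show False by simp
  qed
  then show ?thesis using X(1) by (simp add: superheavy_def)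
qed

end
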